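(* Let $(\mathsf{T},\mu,\eta)$ be a monad on a category $\mathbb{X}$ with finite biproducts that also has negatives. Then $(\mathsf{T},\mu,\eta)$ is a Hopf monad if and only if for all pairs of objects $A,B\in\mathbb{X}$ the following equality holds: $$\mathsf{T}(1_A\oplus 0)+\mathsf{T}(\iota_2)\circ\eta_{\mathsf{T}(B)}\circ\mu_B\circ\mathsf{T}(\pi_2)-\mathsf{T}(\iota_2)\circ\eta_{\mathsf{T}(B)}\circ\mathsf{T}(0)=1_{\mathsf{T}(A\oplus\mathsf{T}(B))},$$ where $\iota_2:\mathsf{T}(B)\to A\oplus\mathsf{T}(B)$ and $\pi_2:A\oplus\mathsf{T}(B)\to\mathsf{T}(B)$ are the second injection and projection, $1_A\oplus 0$ is the endomorphism $\iota_1\circ\pi_1$ of $A\oplus\mathsf{T}(B)$, and in the last term $0:A\oplus\mathsf{T}(B)\to B$ is the zero map.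
   Context: In a category $\mathbb{X}$ with finite biproducts, $\oplus$ denotes the biproduct, with injections $\iota_j$ and projections $\pi_j$; $f+g$ denotes the sum of parallel maps and $0$ the zero maps in the induced commutative monoid enrichment. The category has negatives if every map $f$ has an additive inverse $-f$ (so every homset is an Abelian group). A monad is a triple $(\mathsf{T},\mu,\eta)$ with endofunctor $\mathsf{T}$ (not assumed additive, nor to preserve zero maps), multiplication $\mu_A:\mathsf{T}\mathsf{T}(A)\to\mathsf{T}(A)$ and unit $\eta_A:A\to\mathsf{T}(A)$. The fusion operator of a monad $(\mathsf{T},\mu,\eta)$ on $\mathbb{X}$ is the natural transformation $\mathsf{h}_{A,B}:\mathsf{T}(A\oplus\mathsf{T}(B))\to\mathsf{T}(A)\oplus\mathsf{T}(B)$ defined by $\mathsf{h}_{A,B}=\iota_1\circ\mathsf{T}(\pi_1)+\iota_2\circ\mu_B\circ\mathsf{T}(\pi_2)$. The monad is a Hopf monad if $\mathsf{h}$ is a natural isomorphism. *)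

theory Defs
  imports Main
begin

section \<open>Categories\<close>

record ('o, 'm) cat =
  Obj :: "'o set"
  Arr :: "'m set"
  Dom :: "'m \<Rightarrow> 'o"
  Cod :: "'m \<Rightarrow> 'o"
  Comp :: "'m \<Rightarrow> 'm \<Rightarrow> 'm"  (infixr "\<cdot>\<index>" 75)
  Ident :: "'o \<Rightarrow> 'm"  ("\<one>\<index>")

definition Hom :: "('o, 'm, 'z) cat_scheme \<Rightarrow> 'o \<Rightarrow> 'o \<Rightarrow> 'm set" where
  "Hom C A B = {f \<in> Arr C. Dom C f = A \<and> Cod C f = B}"

locale category =
  fixes C :: "('o, 'm, 'z) cat_scheme" (structure)
  assumes Dom_in_Obj: "f \<in> Arr C \<Longrightarrow> Dom C f \<in> Obj C"
    and Cod_in_Obj: "f \<in> Arr C \<Longrightarrow> Cod C f \<in> Obj C"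
    and Ident_in_Hom: "A \<in> Obj C \<Longrightarrow> \<one> A \<in> Hom C A A"
    and Comp_in_Hom: "f \<in> Hom C A B \<Longrightarrow> g \<in> Hom C B D \<Longrightarrow> g \<cdot> f \<in> Hom C A D"
    and Comp_Ident: "f \<in> Hom C A B \<Longrightarrow> f \<cdot> \<one> A = f"
    and Ident_Comp: "f \<in> Hom C A B \<Longrightarrow> \<one> B \<cdot> f = f"
    and Comp_assoc: "f \<in> Hom C A B \<Longrightarrow> g \<in> Hom C B D \<Longrightarrow> h \<in> Hom C D E \<Longrightarrow>
          (h \<cdot> g) \<cdot> f = h \<cdot> (g \<cdot> f)"

definition is_iso :: "('o, 'm, 'z) cat_scheme \<Rightarrow> 'm \<Rightarrow> bool" where
  "is_iso C f \<longleftrightarrow> f \<in> Arr C \<and>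
     (\<exists>g \<in> Hom C (Cod C f) (Dom C f).
        g \<cdot>\<^bsub>C\<^esub> f = \<one>\<^bsub>C\<^esub> (Dom C f) \<and> f \<cdot>\<^bsub>C\<^esub> g = \<one>\<^bsub>C\<^esub> (Cod C f))"

definition prod_cat ::
  "('o1, 'm1, 'y) cat_scheme \<Rightarrow> ('o2, 'm2, 'z) cat_scheme \<Rightarrow> ('o1 \<times> 'o2, 'm1 \<times> 'm2) cat" where
  "prod_cat C D =
     \<lparr>Obj = Obj C \<times> Obj D, Arr = Arr C \<times> Arr D,
      Dom = (\<lambda>(f, g). (Dom C f, Dom D g)), Cod = (\<lambda>(f, g). (Cod C f, Cod D g)),
      Comp = (\<lambda>(f, g) (f', g'). (f \<cdot>\<^bsub>C\<^esub> f', g \<cdot>\<^bsub>D\<^esub> g')),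
      Ident = (\<lambda>(A, B). (\<one>\<^bsub>C\<^esub> A, \<one>\<^bsub>D\<^esub> B))\<rparr>"

section \<open>Functors, natural transformations and monads\<close>

record ('o1, 'm1, 'o2, 'm2) fctr =
  ObjMap :: "'o1 \<Rightarrow> 'o2"
  ArrMap :: "'m1 \<Rightarrow> 'm2"

locale is_functor = C: category C + D: category D
  for C :: "('o1, 'm1, 'y) cat_scheme" and D :: "('o2, 'm2, 'z) cat_scheme" +
  fixes F :: "('o1, 'm1, 'o2, 'm2) fctr"
  assumes ObjMap_in_Obj: "A \<in> Obj C \<Longrightarrow> ObjMap F A \<in> Obj D"
    and ArrMap_in_Hom: "f \<in> Hom C A B \<Longrightarrow> ArrMap F f \<in> Hom D (ObjMap F A) (ObjMap F B)"
    and ArrMap_Ident: "A \<in> Obj C \<Longrightarrow> ArrMap F (\<one>\<^bsub>C\<^esub> A) = \<one>\<^bsub>D\<^esub> (ObjMap F A)"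
    and ArrMap_Comp: "f \<in> Hom C A B \<Longrightarrow> g \<in> Hom C B E \<Longrightarrow>
          ArrMap F (g \<cdot>\<^bsub>C\<^esub> f) = ArrMap F g \<cdot>\<^bsub>D\<^esub> ArrMap F f"

definition id_fctr :: "('o, 'm, 'o, 'm) fctr" where
  "id_fctr = \<lparr>ObjMap = (\<lambda>A. A), ArrMap = (\<lambda>f. f)\<rparr>"

definition comp_fctr ::
  "('o2, 'm2, 'o3, 'm3) fctr \<Rightarrow> ('o1, 'm1, 'o2, 'm2) fctr \<Rightarrow> ('o1, 'm1, 'o3, 'm3) fctr" where
  "comp_fctr G F = \<lparr>ObjMap = (\<lambda>A. ObjMap G (ObjMap F A)), ArrMap = (\<lambda>f. ArrMap G (ArrMap F f))\<rparr>"

locale natural_transformation = F: is_functor C D F + G: is_functor C D G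
  for C :: "('o1, 'm1, 'y) cat_scheme" and D :: "('o2, 'm2, 'z) cat_scheme"
    and F :: "('o1, 'm1, 'o2, 'm2) fctr" and G :: "('o1, 'm1, 'o2, 'm2) fctr" +
  fixes \<alpha> :: "'o1 \<Rightarrow> 'm2"
  assumes component_in_Hom: "A \<in> Obj C \<Longrightarrow> \<alpha> A \<in> Hom D (ObjMap F A) (ObjMap G A)"
    and naturality: "f \<in> Hom C A B \<Longrightarrow> \<alpha> B \<cdot>\<^bsub>D\<^esub> ArrMap F f = ArrMap G f \<cdot>\<^bsub>D\<^esub> \<alpha> A"

locale natural_isomorphism = natural_transformation +
  assumes component_iso: "A \<in> Obj C \<Longrightarrow> is_iso D (\<alpha> A)"

locale monad = T: is_functor C C T
    + \<mu>: natural_transformation C C "comp_fctr T T" T \<mu>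
    + \<eta>: natural_transformation C C id_fctr T \<eta>
  for C :: "('o, 'm, 'z) cat_scheme" (structure)
    and T :: "('o, 'm, 'o, 'm) fctr" and \<mu> :: "'o \<Rightarrow> 'm" and \<eta> :: "'o \<Rightarrow> 'm" +
  assumes mult_assoc: "A \<in> Obj C \<Longrightarrow> \<mu> A \<cdot> ArrMap T (\<mu> A) = \<mu> A \<cdot> \<mu> (ObjMap T A)"
    and unit_left: "A \<in> Obj C \<Longrightarrow> \<mu> A \<cdot> \<eta> (ObjMap T A) = \<one> (ObjMap T A)"
    and unit_right: "A \<in> Obj C \<Longrightarrow> \<mu> A \<cdot> ArrMap T (\<eta> A) = \<one> (ObjMap T A)"

section \<open>Finite biproducts\<close>

definition is_initial :: "('o, 'm, 'z) cat_scheme \<Rightarrow> 'o \<Rightarrow> bool" where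
  "is_initial C Z \<longleftrightarrow> Z \<in> Obj C \<and> (\<forall>A \<in> Obj C. \<exists>!f. f \<in> Hom C Z A)"

definition is_terminal :: "('o, 'm, 'z) cat_scheme \<Rightarrow> 'o \<Rightarrow> bool" where
  "is_terminal C Z \<longleftrightarrow> Z \<in> Obj C \<and> (\<forall>A \<in> Obj C. \<exists>!f. f \<in> Hom C A Z)"

definition is_product ::
  "('o, 'm, 'z) cat_scheme \<Rightarrow> 'o \<Rightarrow> 'o \<Rightarrow> 'o \<Rightarrow> 'm \<Rightarrow> 'm \<Rightarrow> bool" where
  "is_product C A B P p q \<longleftrightarrow>
     P \<in> Obj C \<and> p \<in> Hom C P A \<and> q \<in> Hom C P B \<and>
     (\<forall>D \<in> Obj C. \<forall>f \<in> Hom C D A. \<forall>g \<in> Hom C D B.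
        \<exists>!h. h \<in> Hom C D P \<and> p \<cdot>\<^bsub>C\<^esub> h = f \<and> q \<cdot>\<^bsub>C\<^esub> h = g)"

definition is_coproduct ::
  "('o, 'm, 'z) cat_scheme \<Rightarrow> 'o \<Rightarrow> 'o \<Rightarrow> 'o \<Rightarrow> 'm \<Rightarrow> 'm \<Rightarrow> bool" where
  "is_coproduct C A B P i j \<longleftrightarrow>
     P \<in> Obj C \<and> i \<in> Hom C A P \<and> j \<in> Hom C B P \<and>
     (\<forall>D \<in> Obj C. \<forall>f \<in> Hom C A D. \<forall>g \<in> Hom C B D.
        \<exists>!h. h \<in> Hom C P D \<and> h \<cdot>\<^bsub>C\<^esub> i = f \<and> h \<cdot>\<^bsub>C\<^esub> j = g)"

record ('o, 'm) bicat = "('o, 'm) cat" +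
  ZeroObj :: 'o
  BSum :: "'o \<Rightarrow> 'o \<Rightarrow> 'o"  (infixr "\<oplus>\<index>" 65)
  Inj1 :: "'o \<Rightarrow> 'o \<Rightarrow> 'm"  ("\<iota>1\<index>")
  Inj2 :: "'o \<Rightarrow> 'o \<Rightarrow> 'm"  ("\<iota>2\<index>")
  Proj1 :: "'o \<Rightarrow> 'o \<Rightarrow> 'm"  ("\<pi>1\<index>")
  Proj2 :: "'o \<Rightarrow> 'o \<Rightarrow> 'm"  ("\<pi>2\<index>")

definition zero_map :: "('o, 'm, 'z) bicat_scheme \<Rightarrow> 'o \<Rightarrow> 'o \<Rightarrow> 'm"  ("\<zero>\<index>") where
  "\<zero>\<^bsub>C\<^esub> A B = (THE g. g \<in> Hom C (ZeroObj C) B) \<cdot>\<^bsub>C\<^esub> (THE f. f \<in> Hom C A (ZeroObj C))"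

locale biproduct_category = category C
  for C :: "('o, 'm, 'z) bicat_scheme" (structure) +
  assumes zero_initial: "is_initial C (ZeroObj C)"
    and zero_terminal: "is_terminal C (ZeroObj C)"
    and biproduct_product: "A \<in> Obj C \<Longrightarrow> B \<in> Obj C \<Longrightarrow>
          is_product C A B (A \<oplus> B) (\<pi>1 A B) (\<pi>2 A B)"
    and biproduct_coproduct: "A \<in> Obj C \<Longrightarrow> B \<in> Obj C \<Longrightarrow>
          is_coproduct C A B (A \<oplus> B) (\<iota>1 A B) (\<iota>2 A B)"
    and Proj1_Inj1: "A \<in> Obj C \<Longrightarrow> B \<in> Obj C \<Longrightarrow> \<pi>1 A B \<cdot> \<iota>1 A B = \<one> A"
    and Proj2_Inj1: "A \<in> Obj C \<Longrightarrow> B \<in> Obj C \<Longrightarrow> \<pi>2 A B \<cdot> \<iota>1 A B = \<zero> A B"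
    and Proj1_Inj2: "A \<in> Obj C \<Longrightarrow> B \<in> Obj C \<Longrightarrow> \<pi>1 A B \<cdot> \<iota>2 A B = \<zero> B A"
    and Proj2_Inj2: "A \<in> Obj C \<Longrightarrow> B \<in> Obj C \<Longrightarrow> \<pi>2 A B \<cdot> \<iota>2 A B = \<one> B"

definition pairing :: "('o, 'm, 'z) bicat_scheme \<Rightarrow> 'm \<Rightarrow> 'm \<Rightarrow> 'm" where
  "pairing C f g =
     (THE h. h \<in> Hom C (Dom C f) (Cod C f \<oplus>\<^bsub>C\<^esub> Cod C g) \<and>
        \<pi>1\<^bsub>C\<^esub> (Cod C f) (Cod C g) \<cdot>\<^bsub>C\<^esub> h = f \<and> \<pi>2\<^bsub>C\<^esub> (Cod C f) (Cod C g) \<cdot>\<^bsub>C\<^esub> h = g)"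

definition copairing :: "('o, 'm, 'z) bicat_scheme \<Rightarrow> 'm \<Rightarrow> 'm \<Rightarrow> 'm" where
  "copairing C f g =
     (THE h. h \<in> Hom C (Dom C f \<oplus>\<^bsub>C\<^esub> Dom C g) (Cod C f) \<and>
        h \<cdot>\<^bsub>C\<^esub> \<iota>1\<^bsub>C\<^esub> (Dom C f) (Dom C g) = f \<and> h \<cdot>\<^bsub>C\<^esub> \<iota>2\<^bsub>C\<^esub> (Dom C f) (Dom C g) = g)"

definition bsum_map :: "('o, 'm, 'z) bicat_scheme \<Rightarrow> 'm \<Rightarrow> 'm \<Rightarrow> 'm" where
  "bsum_map C f g =
     pairing C (f \<cdot>\<^bsub>C\<^esub> \<pi>1\<^bsub>C\<^esub> (Dom C f) (Dom C g)) (g \<cdot>\<^bsub>C\<^esub> \<pi>2\<^bsub>C\<^esub> (Dom C f) (Dom C g))"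

text \<open>The map written \<open>1 \<oplus> 0\<close>, built with \<^const>\<open>bsum_map\<close>, is \<open>\<iota>1 \<cdot> \<pi>1\<close>.\<close>

lemma (in biproduct_category) bsum_map_Ident_zero:
  assumes A: "A \<in> Obj C" and B: "B \<in> Obj C"
  shows "bsum_map C (\<one> A) (\<zero> B B) = \<iota>1 A B \<cdot> \<pi>1 A B"
proof -
  note P = biproduct_product[OF A B, unfolded is_product_def]
  note Q = biproduct_coproduct[OF A B, unfolded is_coproduct_def]
  let ?Z = "ZeroObj C"
  have Z: "?Z \<in> Obj C" using zero_initial by (simp add: is_initial_def)
  have ini: "\<exists>!f. f \<in> Hom C ?Z D" if "D \<in> Obj C" for D
    using zero_initial that by (simp add: is_initial_def)
  have ter: "\<exists>!f. f \<in> Hom C D ?Z" if "D \<in> Obj C" for D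
    using zero_terminal that by (simp add: is_terminal_def)
  note iH = theI'[OF ini] and tH = theI'[OF ter]
  have zH: "\<zero> D E \<in> Hom C D E" if "D \<in> Obj C" "E \<in> Obj C" for D E
    unfolding zero_map_def using Comp_in_Hom[OF tH[OF that(1)] iH[OF that(2)]] .
  have zc: "\<zero> D E \<cdot> f = \<zero> K E" if "f \<in> Hom C K D" "K \<in> Obj C" "D \<in> Obj C" "E \<in> Obj C" for f K D E
    unfolding zero_map_def
    using Comp_assoc[OF that(1) tH[OF that(3)] iH[OF that(4)]]
      ter[OF that(2)] tH[OF that(2)] Comp_in_Hom[OF that(1) tH[OF that(3)]]
    by metis
  have p: "\<pi>1 A B \<in> Hom C (A \<oplus> B) A" "\<pi>2 A B \<in> Hom C (A \<oplus> B) B" and O: "A \<oplus> B \<in> Obj C"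
    and i: "\<iota>1 A B \<in> Hom C A (A \<oplus> B)" using P Q by auto
  have e1: "\<one> A \<cdot> \<pi>1 A B = \<pi>1 A B" using Ident_Comp p(1) .
  have e2: "\<zero> B B \<cdot> \<pi>2 A B = \<zero> (A \<oplus> B) B" using zc[OF p(2) O B B] .
  have d: "Dom C (\<one> A) = A" "Dom C (\<zero> B B) = B" "Dom C (\<pi>1 A B) = A \<oplus> B" "Cod C (\<pi>1 A B) = A"
    "Cod C (\<zero> (A \<oplus> B) B) = B"
    using Ident_in_Hom[OF A] zH[OF B B] p(1) zH[OF O B] by (auto simp: Hom_def)
  have h: "\<iota>1 A B \<cdot> \<pi>1 A B \<in> Hom C (A \<oplus> B) (A \<oplus> B)"
    using Comp_in_Hom[OF p(1) i] .
  have h1: "\<pi>1 A B \<cdot> \<iota>1 A B \<cdot> \<pi>1 A B = \<pi>1 A B"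
    using Comp_assoc[OF p(1) i p(1)] Proj1_Inj1[OF A B] e1 by simp
  have h2: "\<pi>2 A B \<cdot> \<iota>1 A B \<cdot> \<pi>1 A B = \<zero> (A \<oplus> B) B"
    using Comp_assoc[OF p(1) i p(2)] Proj2_Inj1[OF A B] zc[OF p(1) O A B] by simp
  have u: "\<exists>!h. h \<in> Hom C (A \<oplus> B) (A \<oplus> B) \<and> \<pi>1 A B \<cdot> h = \<pi>1 A B \<and> \<pi>2 A B \<cdot> h = \<zero> (A \<oplus> B) B"
    using P O p(1) zH[OF O B] by blast
  show ?thesis
    unfolding bsum_map_def d e1 e2 pairing_def
    by (rule the1_equality[OF u]) (use h h1 h2 in blast)
qed

text \<open>The commutative monoid enrichment is the one induced by the biproducts: the sum of
  \<open>f, g : A \<rightarrow> B\<close> is the pairing \<open>A \<rightarrow> B \<oplus> B\<close> followed by the codiagonal of \<open>B\<close>.\<close>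

definition add_map :: "('o, 'm, 'z) bicat_scheme \<Rightarrow> 'm \<Rightarrow> 'm \<Rightarrow> 'm"  (infixl "\<^bold>+\<index>" 65) where
  "f \<^bold>+\<^bsub>C\<^esub> g = copairing C (\<one>\<^bsub>C\<^esub> (Cod C f)) (\<one>\<^bsub>C\<^esub> (Cod C f)) \<cdot>\<^bsub>C\<^esub> pairing C f g"

definition has_negatives :: "('o, 'm, 'z) bicat_scheme \<Rightarrow> bool" where
  "has_negatives C \<longleftrightarrow>
     (\<forall>A \<in> Obj C. \<forall>B \<in> Obj C. \<forall>f \<in> Hom C A B. \<exists>g \<in> Hom C A B. f \<^bold>+\<^bsub>C\<^esub> g = \<zero>\<^bsub>C\<^esub> A B)"

definition neg_map :: "('o, 'm, 'z) bicat_scheme \<Rightarrow> 'm \<Rightarrow> 'm" where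
  "neg_map C f =
     (THE g. g \<in> Hom C (Dom C f) (Cod C f) \<and> f \<^bold>+\<^bsub>C\<^esub> g = \<zero>\<^bsub>C\<^esub> (Dom C f) (Cod C f))"

definition diff_map :: "('o, 'm, 'z) bicat_scheme \<Rightarrow> 'm \<Rightarrow> 'm \<Rightarrow> 'm"  (infixl "\<^bold>-\<index>" 65) where
  "f \<^bold>-\<^bsub>C\<^esub> g = f \<^bold>+\<^bsub>C\<^esub> neg_map C g"

section \<open>Hopf monads\<close>

definition fusion ::
  "('o, 'm, 'z) bicat_scheme \<Rightarrow> ('o, 'm, 'o, 'm) fctr \<Rightarrow> ('o \<Rightarrow> 'm) \<Rightarrow> 'o \<times> 'o \<Rightarrow> 'm" where
  "fusion C T \<mu> = (\<lambda>(A, B).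
     \<iota>1\<^bsub>C\<^esub> (ObjMap T A) (ObjMap T B) \<cdot>\<^bsub>C\<^esub> ArrMap T (\<pi>1\<^bsub>C\<^esub> A (ObjMap T B))
     \<^bold>+\<^bsub>C\<^esub> \<iota>2\<^bsub>C\<^esub> (ObjMap T A) (ObjMap T B) \<cdot>\<^bsub>C\<^esub> \<mu> B \<cdot>\<^bsub>C\<^esub> ArrMap T (\<pi>2\<^bsub>C\<^esub> A (ObjMap T B)))"

definition fusion_source ::
  "('o, 'm, 'z) bicat_scheme \<Rightarrow> ('o, 'm, 'o, 'm) fctr \<Rightarrow> ('o \<times> 'o, 'm \<times> 'm, 'o, 'm) fctr" where
  "fusion_source C T =
     \<lparr>ObjMap = (\<lambda>(A, B). ObjMap T (A \<oplus>\<^bsub>C\<^esub> ObjMap T B)),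
      ArrMap = (\<lambda>(f, g). ArrMap T (bsum_map C f (ArrMap T g)))\<rparr>"

definition fusion_target ::
  "('o, 'm, 'z) bicat_scheme \<Rightarrow> ('o, 'm, 'o, 'm) fctr \<Rightarrow> ('o \<times> 'o, 'm \<times> 'm, 'o, 'm) fctr" where
  "fusion_target C T =
     \<lparr>ObjMap = (\<lambda>(A, B). ObjMap T A \<oplus>\<^bsub>C\<^esub> ObjMap T B),
      ArrMap = (\<lambda>(f, g). bsum_map C (ArrMap T f) (ArrMap T g))\<rparr>"

locale hopf_monad = biproduct_category C + monad C T \<mu> \<eta>
  for C :: "('o, 'm, 'z) bicat_scheme" (structure)
    and T :: "('o, 'm, 'o, 'm) fctr" and \<mu> :: "'o \<Rightarrow> 'm" and \<eta> :: "'o \<Rightarrow> 'm" +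
  assumes fusion_iso:
    "natural_isomorphism (prod_cat C C) C (fusion_source C T) (fusion_target C T) (fusion C T \<mu>)"

end

theory Submission
  imports Defs
begin

text \<open>Let \<open>h\<close> be the fusion operator and
  \<open>g = T \<iota>1 \<cdot> \<pi>1 + T \<iota>2 \<cdot> \<eta> \<cdot> \<pi>2 - T \<iota>2 \<cdot> \<eta> \<cdot> T 0 \<cdot> \<pi>1\<close>.  Naturality of \<open>\<eta>\<close> gives
  \<open>T 0 \<cdot> \<eta> = 0\<close>, and \<open>0 = \<eta> \<cdot> 0\<close> gives \<open>\<mu> \<cdot> T 0 = T 0\<close>; hence \<open>h \<cdot> g = 1\<close> holds in every monad.
  The left-hand side of the required identity is \<open>g \<cdot> h\<close>, so the identity says precisely that
  the section \<open>g\<close> is also a left inverse of \<open>h\<close>.\<close>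

section \<open>Typing rules for composites\<close>

text \<open>Trading \<open>Hom\<close> membership for conditions on \<open>Arr\<close>,
  \<open>Dom\<close> and \<open>Cod\<close> lets the simplifier compute the types of composites;
  with \<open>Hom\<close> premises it would have to guess the intermediate objects.\<close>

lemma Hom_iff: "f \<in> Hom C A B \<longleftrightarrow> f \<in> Arr C \<and> Dom C f = A \<and> Cod C f = B"
  by (simp add: Hom_def)

context category
begin

declare Dom_in_Obj [simp] Cod_in_Obj [simp]

lemma Ident_arr [simp]:
  assumes "A \<in> Obj C"
  shows "\<one> A \<in> Arr C" "Dom C (\<one> A) = A" "Cod C (\<one> A) = A"
  using Ident_in_Hom[OF assms] by (auto simp: Hom_iff)

lemma Comp_arr [simp]:
  assumes "f \<in> Arr C" "g \<in> Arr C" "Dom C g = Cod C f"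
  shows "g \<cdot> f \<in> Arr C" "Dom C (g \<cdot> f) = Dom C f" "Cod C (g \<cdot> f) = Cod C g"
  using Comp_in_Hom[of f "Dom C f" "Cod C f" g "Cod C g"] assms by (auto simp: Hom_iff)

lemma Comp_Ident_arr [simp]: "f \<in> Arr C \<Longrightarrow> Dom C f = A \<Longrightarrow> f \<cdot> \<one> A = f"
  using Comp_Ident by (auto simp: Hom_iff)

lemma Ident_Comp_arr [simp]: "f \<in> Arr C \<Longrightarrow> Cod C f = A \<Longrightarrow> \<one> A \<cdot> f = f"
  using Ident_Comp by (auto simp: Hom_iff)

lemma Comp_assoc_arr [simp]:
  assumes "f \<in> Arr C" "g \<in> Arr C" "h \<in> Arr C" "Dom C g = Cod C f" "Dom C h = Cod C g"
  shows "(h \<cdot> g) \<cdot> f = h \<cdot> g \<cdot> f"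
  using Comp_assoc[of f "Dom C f" "Cod C f" g "Cod C g" h "Cod C h"] assms by (auto simp: Hom_iff)

text \<open>\<open>Comp_assoc_arr\<close> nests composites to the right, so an equation for
  \<open>h \<cdot> g\<close> no longer matches inside \<open>h \<cdot> g \<cdot> f\<close>. This
  rule equips such an equation with a trailing factor and yields variants such as
  \<open>unit_natural_Comp\<close>.\<close>

lemma Comp_reduce:
  assumes "h \<cdot> g = k" "f \<in> Arr C" "g \<in> Arr C" "h \<in> Arr C" "Dom C g = Cod C f" "Dom C h = Cod C g"
  shows "h \<cdot> g \<cdot> f = k \<cdot> f"
  using assms Comp_assoc_arr by metis

end

section \<open>Addition of parallel maps\<close>

context biproduct_category
begin

section \<open>The zero object and zero maps\<close>

lemma ZeroObj_in_Obj [simp]: "ZeroObj C \<in> Obj C"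
  using zero_initial by (simp add: is_initial_def)

lemma initial_unique: "B \<in> Obj C \<Longrightarrow> \<exists>!f. f \<in> Hom C (ZeroObj C) B"
  using zero_initial by (simp add: is_initial_def)

lemma terminal_unique: "A \<in> Obj C \<Longrightarrow> \<exists>!f. f \<in> Hom C A (ZeroObj C)"
  using zero_terminal by (simp add: is_terminal_def)

lemma zero_map_arr [simp]:
  assumes "A \<in> Obj C" "B \<in> Obj C"
  shows "\<zero> A B \<in> Arr C" "Dom C (\<zero> A B) = A" "Cod C (\<zero> A B) = B"
  using theI'[OF terminal_unique[OF assms(1)]] theI'[OF initial_unique[OF assms(2)]]
  by (auto simp: zero_map_def Hom_iff)

text \<open>Precomposition only affects the leg into the zero object, and that leg is unique.
  \<open>Comp_zero_map\<close> is the dual argument with the leg out of the zero object.\<close>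

lemma zero_map_Comp [simp]:
  assumes "f \<in> Arr C" "Cod C f = A" "B \<in> Obj C"
  shows "\<zero> A B \<cdot> f = \<zero> (Dom C f) B"
proof -
  let ?t = "\<lambda>A. THE f. f \<in> Hom C A (ZeroObj C)"
  have A: "A \<in> Obj C" using assms by auto
  have D: "Dom C f \<in> Obj C" using assms by auto
  note t = theI'[OF terminal_unique[OF A]] theI'[OF terminal_unique[OF D]]
    and i = theI'[OF initial_unique[OF assms(3)]]
  have "?t A \<cdot> f = ?t (Dom C f)"
    using terminal_unique[OF D] t assms by (auto simp: Hom_iff)
  then show ?thesis
    using t i assms by (simp add: zero_map_def Hom_iff)
qed

lemma Comp_zero_map [simp]:
  assumes "f \<in> Arr C" "Dom C f = B" "A \<in> Obj C"
  shows "f \<cdot> \<zero> A B = \<zero> A (Cod C f)"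
proof -
  let ?i = "\<lambda>B. THE f. f \<in> Hom C (ZeroObj C) B"
  have B: "B \<in> Obj C" using assms by auto
  have D: "Cod C f \<in> Obj C" using assms by auto
  note i = theI'[OF initial_unique[OF B]] theI'[OF initial_unique[OF D]]
    and t = theI'[OF terminal_unique[OF assms(3)]]
  have "f \<cdot> ?i B = ?i (Cod C f)"
    using initial_unique[OF D] i assms by (auto simp: Hom_iff)
  moreover have "(f \<cdot> ?i B) \<cdot> (THE f. f \<in> Hom C A (ZeroObj C)) = f \<cdot> \<zero> A B"
    using t i assms by (simp add: zero_map_def Hom_iff)
  ultimately show ?thesis
    by (simp add: zero_map_def)
qed

section \<open>Biproducts and their universal properties\<close>

lemma biproduct_arr [simp]:
  assumes "A \<in> Obj C" "B \<in> Obj C"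
  shows "A \<oplus> B \<in> Obj C"
    "\<pi>1 A B \<in> Arr C" "Dom C (\<pi>1 A B) = A \<oplus> B" "Cod C (\<pi>1 A B) = A"
    "\<pi>2 A B \<in> Arr C" "Dom C (\<pi>2 A B) = A \<oplus> B" "Cod C (\<pi>2 A B) = B"
    "\<iota>1 A B \<in> Arr C" "Dom C (\<iota>1 A B) = A" "Cod C (\<iota>1 A B) = A \<oplus> B"
    "\<iota>2 A B \<in> Arr C" "Dom C (\<iota>2 A B) = B" "Cod C (\<iota>2 A B) = A \<oplus> B"
  using biproduct_product[OF assms] biproduct_coproduct[OF assms]
  by (auto simp: is_product_def is_coproduct_def Hom_iff)

declare Proj1_Inj1 [simp] Proj2_Inj1 [simp] Proj1_Inj2 [simp] Proj2_Inj2 [simp]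

lemma Proj_Inj_Comp [simp]:
  assumes "A \<in> Obj C" "B \<in> Obj C" "f \<in> Arr C"
  shows "Cod C f = A \<Longrightarrow> \<pi>1 A B \<cdot> \<iota>1 A B \<cdot> f = f"
    "Cod C f = A \<Longrightarrow> \<pi>2 A B \<cdot> \<iota>1 A B \<cdot> f = \<zero> (Dom C f) B"
    "Cod C f = B \<Longrightarrow> \<pi>1 A B \<cdot> \<iota>2 A B \<cdot> f = \<zero> (Dom C f) A"
    "Cod C f = B \<Longrightarrow> \<pi>2 A B \<cdot> \<iota>2 A B \<cdot> f = f"
  using assms
  by (simp_all add: Comp_reduce[OF Proj1_Inj1] Comp_reduce[OF Proj2_Inj1]
      Comp_reduce[OF Proj1_Inj2] Comp_reduce[OF Proj2_Inj2])

text \<open>Joint monicity of the projections, from the uniqueness half of the universal property.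
  It is the standard way below to compare maps into a biproduct.\<close>

lemma product_ext:
  assumes "A \<in> Obj C" "B \<in> Obj C" "h \<in> Arr C" "k \<in> Arr C" "Dom C h = Dom C k"
    "Cod C h = A \<oplus> B" "Cod C k = A \<oplus> B"
    "\<pi>1 A B \<cdot> h = \<pi>1 A B \<cdot> k" "\<pi>2 A B \<cdot> h = \<pi>2 A B \<cdot> k"
  shows "h = k"
proof -
  have "\<exists>!l. l \<in> Hom C (Dom C k) (A \<oplus> B) \<and> \<pi>1 A B \<cdot> l = \<pi>1 A B \<cdot> k \<and> \<pi>2 A B \<cdot> l = \<pi>2 A B \<cdot> k"
    using biproduct_product[OF assms(1,2)] assms by (simp add: is_product_def Hom_iff)
  then show ?thesis
    using assms by (auto simp: Hom_iff)
qed

lemma coproduct_ext: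
  assumes "A \<in> Obj C" "B \<in> Obj C" "h \<in> Arr C" "k \<in> Arr C" "Cod C h = Cod C k"
    "Dom C h = A \<oplus> B" "Dom C k = A \<oplus> B"
    "h \<cdot> \<iota>1 A B = k \<cdot> \<iota>1 A B" "h \<cdot> \<iota>2 A B = k \<cdot> \<iota>2 A B"
  shows "h = k"
proof -
  have "\<exists>!l. l \<in> Hom C (A \<oplus> B) (Cod C k) \<and> l \<cdot> \<iota>1 A B = k \<cdot> \<iota>1 A B \<and> l \<cdot> \<iota>2 A B = k \<cdot> \<iota>2 A B"
    using biproduct_coproduct[OF assms(1,2)] assms by (simp add: is_coproduct_def Hom_iff)
  then show ?thesis
    using assms by (auto simp: Hom_iff)
qed

section \<open>Pairing and copairing\<close>

lemma pairing_props:
  assumes "f \<in> Arr C" "g \<in> Arr C" "Dom C g = Dom C f"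
  shows "pairing C f g \<in> Hom C (Dom C f) (Cod C f \<oplus> Cod C g) \<and>
    \<pi>1 (Cod C f) (Cod C g) \<cdot> pairing C f g = f \<and> \<pi>2 (Cod C f) (Cod C g) \<cdot> pairing C f g = g"
  unfolding pairing_def
  by (rule theI') (use biproduct_product[of "Cod C f" "Cod C g"] assms in
      \<open>simp add: is_product_def Hom_iff\<close>)

lemma pairing_arr [simp]:
  assumes "f \<in> Arr C" "g \<in> Arr C" "Dom C g = Dom C f"
  shows "pairing C f g \<in> Arr C" "Dom C (pairing C f g) = Dom C f"
    "Cod C (pairing C f g) = Cod C f \<oplus> Cod C g"
  using pairing_props[OF assms] by (auto simp: Hom_iff)

lemma Proj_pairing [simp]:
  assumes "f \<in> Arr C" "g \<in> Arr C" "Dom C g = Dom C f" "Cod C f = A" "Cod C g = B"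
  shows "\<pi>1 A B \<cdot> pairing C f g = f" "\<pi>2 A B \<cdot> pairing C f g = g"
  using pairing_props[OF assms(1-3)] assms(4,5) by auto

lemma copairing_props:
  assumes "f \<in> Arr C" "g \<in> Arr C" "Cod C g = Cod C f"
  shows "copairing C f g \<in> Hom C (Dom C f \<oplus> Dom C g) (Cod C f) \<and>
    copairing C f g \<cdot> \<iota>1 (Dom C f) (Dom C g) = f \<and> copairing C f g \<cdot> \<iota>2 (Dom C f) (Dom C g) = g"
  unfolding copairing_def
  by (rule theI') (use biproduct_coproduct[of "Dom C f" "Dom C g"] assms in
      \<open>simp add: is_coproduct_def Hom_iff\<close>)

lemma copairing_arr [simp]:
  assumes "f \<in> Arr C" "g \<in> Arr C" "Cod C g = Cod C f"
  shows "copairing C f g \<in> Arr C" "Cod C (copairing C f g) = Cod C f"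
    "Dom C (copairing C f g) = Dom C f \<oplus> Dom C g"
  using copairing_props[OF assms] by (auto simp: Hom_iff)

lemma copairing_Inj [simp]:
  assumes "f \<in> Arr C" "g \<in> Arr C" "Cod C g = Cod C f" "Dom C f = A" "Dom C g = B"
  shows "copairing C f g \<cdot> \<iota>1 A B = f" "copairing C f g \<cdot> \<iota>2 A B = g"
  using copairing_props[OF assms(1-3)] assms(4,5) by auto

lemma copairing_Inj_Comp [simp]:
  assumes "f \<in> Arr C" "g \<in> Arr C" "Cod C g = Cod C f" "Dom C f = A" "Dom C g = B" "k \<in> Arr C"
  shows "Cod C k = A \<Longrightarrow> copairing C f g \<cdot> \<iota>1 A B \<cdot> k = f \<cdot> k"
    "Cod C k = B \<Longrightarrow> copairing C f g \<cdot> \<iota>2 A B \<cdot> k = g \<cdot> k"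
  using assms by (auto simp: Comp_reduce[OF copairing_Inj(1)] Comp_reduce[OF copairing_Inj(2)])

lemma pairing_Comp:
  assumes "f \<in> Arr C" "g \<in> Arr C" "Dom C g = Dom C f" "k \<in> Arr C" "Cod C k = Dom C f"
  shows "pairing C f g \<cdot> k = pairing C (f \<cdot> k) (g \<cdot> k)"
  by (rule product_ext[of "Cod C f" "Cod C g"])
    (use assms in \<open>simp_all add: Comp_reduce[OF Proj_pairing(1)] Comp_reduce[OF Proj_pairing(2)]\<close>)

section \<open>The induced addition and its compatibility with composition\<close>

lemma add_map_arr [simp]:
  assumes "f \<in> Arr C" "g \<in> Arr C" "Dom C g = Dom C f" "Cod C g = Cod C f"
  shows "f \<^bold>+ g \<in> Arr C" "Dom C (f \<^bold>+ g) = Dom C f" "Cod C (f \<^bold>+ g) = Cod C f"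
  using assms by (simp_all add: add_map_def)

text \<open>Precomposition is absorbed by the pairing; the codiagonal is untouched.\<close>

lemma add_map_Comp:
  assumes "f \<in> Arr C" "g \<in> Arr C" "Dom C g = Dom C f" "Cod C g = Cod C f"
    "k \<in> Arr C" "Cod C k = Dom C f"
  shows "(f \<^bold>+ g) \<cdot> k = f \<cdot> k \<^bold>+ g \<cdot> k"
  using assms by (simp add: add_map_def pairing_Comp)

text \<open>The codiagonal is natural: \<open>k\<close> after the codiagonal equals the codiagonal
  after k \<oplus> k. In the proof \<open>?kk\<close> is k \<oplus> k, written out as a
  pairing.\<close>

lemma Comp_add_map:
  assumes "f \<in> Arr C" "g \<in> Arr C" "Dom C g = Dom C f" "Cod C g = Cod C f"
    "k \<in> Arr C" "Dom C k = Cod C f"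
  shows "k \<cdot> (f \<^bold>+ g) = k \<cdot> f \<^bold>+ k \<cdot> g"
proof -
  let ?B = "Cod C f" and ?D = "Cod C k"
  let ?kk = "pairing C (k \<cdot> \<pi>1 ?B ?B) (k \<cdot> \<pi>2 ?B ?B)"
  note R = Comp_reduce[OF Proj_pairing(1)] Comp_reduce[OF Proj_pairing(2)]
  \<comment> \<open>The values of \<open>?kk\<close> on the injections are what
    \<open>coproduct_ext\<close> needs to verify naturality of the codiagonal.\<close>
  have i: "?kk \<cdot> \<iota>1 ?B ?B = \<iota>1 ?D ?D \<cdot> k" "?kk \<cdot> \<iota>2 ?B ?B = \<iota>2 ?D ?D \<cdot> k"
    by (rule product_ext[of ?D ?D]; use assms in \<open>simp add: R\<close>)+
  have 1: "k \<cdot> copairing C (\<one> ?B) (\<one> ?B) = copairing C (\<one> ?D) (\<one> ?D) \<cdot> ?kk"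
    by (rule coproduct_ext[of ?B ?B]) (use assms in \<open>simp_all add: i\<close>)
  have 2: "?kk \<cdot> pairing C f g = pairing C (k \<cdot> f) (k \<cdot> g)"
    by (rule product_ext[of ?D ?D]) (use assms in \<open>simp_all add: R\<close>)
  have "k \<cdot> (f \<^bold>+ g) = (k \<cdot> copairing C (\<one> ?B) (\<one> ?B)) \<cdot> pairing C f g"
    using assms by (simp add: add_map_def)
  also have "\<dots> = copairing C (\<one> ?D) (\<one> ?D) \<cdot> ?kk \<cdot> pairing C f g"
    unfolding 1 using assms by simp
  finally show ?thesis
    unfolding 2 using assms by (simp add: add_map_def)
qed

text \<open>Pairing with a zero map amounts to composing with an injection, and the codiagonal sends
  either injection to the identity.\<close>

lemma add_zero_map [simp]:
  assumes "f \<in> Arr C" "Dom C f = A" "Cod C f = B"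
  shows "f \<^bold>+ \<zero> A B = f" "\<zero> A B \<^bold>+ f = f"
proof -
  have O: "A \<in> Obj C" "B \<in> Obj C" using assms by auto
  have "pairing C f (\<zero> A B) = \<iota>1 B B \<cdot> f" "pairing C (\<zero> A B) f = \<iota>2 B B \<cdot> f"
    by (rule product_ext[of B B]; use assms O in simp)+
  then show "f \<^bold>+ \<zero> A B = f" "\<zero> A B \<^bold>+ f = f"
    using assms O by (simp_all add: add_map_def)
qed

text \<open>Since \<open>\<nabla> \<cdot> (u + v) = \<nabla> \<cdot> u + \<nabla> \<cdot> v\<close> for \<open>u = \<langle>a, b\<rangle>\<close> and \<open>v = \<langle>c, d\<rangle>\<close>, addition satisfies
  the interchange law; commutativity and associativity follow as in the Eckmann--Hilton argument.\<close>

lemma add_map_interchange: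
  assumes "a \<in> Hom C A B" "b \<in> Hom C A B" "c \<in> Hom C A B" "d \<in> Hom C A B"
  shows "(a \<^bold>+ b) \<^bold>+ (c \<^bold>+ d) = (a \<^bold>+ c) \<^bold>+ (b \<^bold>+ d)"
proof -
  have O: "A \<in> Obj C" "B \<in> Obj C" using assms by (auto simp: Hom_iff)
  have "pairing C a b \<^bold>+ pairing C c d = pairing C (a \<^bold>+ c) (b \<^bold>+ d)"
    by (rule product_ext[of B B]) (use assms O in \<open>simp_all add: Hom_iff Comp_add_map\<close>)
  then have "copairing C (\<one> B) (\<one> B) \<cdot> pairing C a b \<^bold>+ copairing C (\<one> B) (\<one> B) \<cdot> pairing C c d
      = copairing C (\<one> B) (\<one> B) \<cdot> pairing C (a \<^bold>+ c) (b \<^bold>+ d)"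
    using assms O
      Comp_add_map[of "pairing C a b" "pairing C c d" "copairing C (\<one> B) (\<one> B)"]
    by (simp add: Hom_iff)
  then show ?thesis
    using assms O by (simp add: add_map_def Hom_iff)
qed

lemma add_map_commute:
  assumes "f \<in> Hom C A B" "g \<in> Hom C A B"
  shows "f \<^bold>+ g = g \<^bold>+ f"
proof -
  have O: "A \<in> Obj C" "B \<in> Obj C" using assms by (auto simp: Hom_iff)
  \<comment> \<open>Interchange reads (0 + f) + (g + 0) = (0 + g) + (f + 0).\<close>
  show ?thesis
    using add_map_interchange[of "\<zero> A B" A B f g "\<zero> A B"] assms O by (simp add: Hom_iff)
qed

lemma add_map_assoc:
  assumes "f \<in> Hom C A B" "g \<in> Hom C A B" "h \<in> Hom C A B"
  shows "(f \<^bold>+ g) \<^bold>+ h = f \<^bold>+ (g \<^bold>+ h)"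
proof -
  have O: "A \<in> Obj C" "B \<in> Obj C" using assms by (auto simp: Hom_iff)
  \<comment> \<open>Interchange reads (f + g) + (0 + h) = (f + 0) + (g + h).\<close>
  show ?thesis
    using add_map_interchange[of f A B g "\<zero> A B" h] assms O by (simp add: Hom_iff)
qed

section \<open>Functoriality of the biproduct\<close>

lemma bsum_map_arr [simp]:
  assumes "f \<in> Arr C" "g \<in> Arr C"
  shows "bsum_map C f g \<in> Arr C" "Dom C (bsum_map C f g) = Dom C f \<oplus> Dom C g"
    "Cod C (bsum_map C f g) = Cod C f \<oplus> Cod C g"
  using assms by (simp_all add: bsum_map_def)

lemma Proj_bsum_map [simp]:
  assumes "f \<in> Arr C" "g \<in> Arr C" "Cod C f = A" "Cod C g = B"
  shows "\<pi>1 A B \<cdot> bsum_map C f g = f \<cdot> \<pi>1 (Dom C f) (Dom C g)"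
    "\<pi>2 A B \<cdot> bsum_map C f g = g \<cdot> \<pi>2 (Dom C f) (Dom C g)"
  using assms by (simp_all add: bsum_map_def)

lemma Proj_bsum_map_Comp [simp]:
  assumes "f \<in> Arr C" "g \<in> Arr C" "Cod C f = A" "Cod C g = B"
    "k \<in> Arr C" "Cod C k = Dom C f \<oplus> Dom C g"
  shows "\<pi>1 A B \<cdot> bsum_map C f g \<cdot> k = f \<cdot> \<pi>1 (Dom C f) (Dom C g) \<cdot> k"
    "\<pi>2 A B \<cdot> bsum_map C f g \<cdot> k = g \<cdot> \<pi>2 (Dom C f) (Dom C g) \<cdot> k"
  using assms
  by (auto simp: Comp_reduce[OF Proj_bsum_map(1)] Comp_reduce[OF Proj_bsum_map(2)])

lemma bsum_map_Ident [simp]: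
  assumes "A \<in> Obj C" "B \<in> Obj C"
  shows "bsum_map C (\<one> A) (\<one> B) = \<one> (A \<oplus> B)"
  by (rule product_ext[of A B]) (use assms in simp_all)

lemma bsum_map_Comp:
  assumes "f \<in> Arr C" "g \<in> Arr C" "f' \<in> Arr C" "g' \<in> Arr C" "Dom C f' = Cod C f" "Dom C g' = Cod C g"
  shows "bsum_map C (f' \<cdot> f) (g' \<cdot> g) = bsum_map C f' g' \<cdot> bsum_map C f g"
  by (rule product_ext[of "Cod C f'" "Cod C g'"]) (use assms in simp_all)

end

section \<open>Negatives\<close>

locale biproduct_category_with_negatives = biproduct_category +
  assumes negatives: "has_negatives C"
begin

text \<open>Makes the description in \<open>neg_map\<close> well defined:
  \<open>has_negatives\<close> gives existence, and inverses in a commutative monoid are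
  unique.\<close>

lemma neg_map_unique: "f \<in> Arr C \<Longrightarrow> \<exists>!g. g \<in> Hom C (Dom C f) (Cod C f) \<and> f \<^bold>+ g = \<zero> (Dom C f) (Cod C f)"
proof (rule ex_ex1I)
  let ?A = "Dom C f" and ?B = "Cod C f"
  assume f: "f \<in> Arr C"
  show "\<exists>g. g \<in> Hom C ?A ?B \<and> f \<^bold>+ g = \<zero> ?A ?B"
    using negatives f by (force simp: has_negatives_def Hom_iff)
  fix g h
  assume g: "g \<in> Hom C ?A ?B \<and> f \<^bold>+ g = \<zero> ?A ?B" and h: "h \<in> Hom C ?A ?B \<and> f \<^bold>+ h = \<zero> ?A ?B"
  have F: "f \<in> Hom C ?A ?B" using f by (simp add: Hom_iff)
  have "g = g \<^bold>+ (f \<^bold>+ h)" using g h by (simp add: Hom_iff)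
  also have "\<dots> = (f \<^bold>+ g) \<^bold>+ h"
    using add_map_assoc[of g ?A ?B f h] add_map_commute[of g ?A ?B f] g h F by simp
  also have "\<dots> = h" using g h by (simp add: Hom_iff)
  finally show "g = h" .
qed

lemma neg_map_arr [simp]:
  assumes "f \<in> Arr C"
  shows "neg_map C f \<in> Arr C" "Dom C (neg_map C f) = Dom C f" "Cod C (neg_map C f) = Cod C f"
  using theI'[OF neg_map_unique[OF assms]] by (auto simp: neg_map_def Hom_iff)

lemma add_neg_map [simp]: "f \<in> Arr C \<Longrightarrow> f \<^bold>+ neg_map C f = \<zero> (Dom C f) (Cod C f)"
  using theI'[OF neg_map_unique, of f] by (simp add: neg_map_def)

lemma neg_map_eqI:
  assumes "f \<in> Arr C" "g \<in> Arr C" "Dom C g = Dom C f" "Cod C g = Cod C f"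
    "f \<^bold>+ g = \<zero> (Dom C f) (Cod C f)"
  shows "neg_map C f = g"
  using neg_map_unique[OF assms(1)] assms by (metis Hom_iff add_neg_map neg_map_arr)

lemma Comp_neg_map:
  assumes "f \<in> Arr C" "k \<in> Arr C" "Dom C k = Cod C f"
  shows "k \<cdot> neg_map C f = neg_map C (k \<cdot> f)"
  by (rule neg_map_eqI[symmetric]) (use assms in \<open>simp_all add: Comp_add_map[symmetric]\<close>)

lemma neg_map_Comp:
  assumes "f \<in> Arr C" "k \<in> Arr C" "Cod C k = Dom C f"
  shows "neg_map C f \<cdot> k = neg_map C (f \<cdot> k)"
  by (rule neg_map_eqI[symmetric]) (use assms in \<open>simp_all add: add_map_Comp[symmetric]\<close>)

lemma diff_map_arr [simp]:
  assumes "f \<in> Arr C" "g \<in> Arr C" "Dom C g = Dom C f" "Cod C g = Cod C f"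
  shows "f \<^bold>- g \<in> Arr C" "Dom C (f \<^bold>- g) = Dom C f" "Cod C (f \<^bold>- g) = Cod C f"
  using assms by (simp_all add: diff_map_def)

lemma diff_map_Comp:
  assumes "f \<in> Arr C" "g \<in> Arr C" "Dom C g = Dom C f" "Cod C g = Cod C f"
    "k \<in> Arr C" "Cod C k = Dom C f"
  shows "(f \<^bold>- g) \<cdot> k = f \<cdot> k \<^bold>- g \<cdot> k"
  using assms by (simp add: diff_map_def add_map_Comp neg_map_Comp)

lemma Comp_diff_map:
  assumes "f \<in> Arr C" "g \<in> Arr C" "Dom C g = Dom C f" "Cod C g = Cod C f"
    "k \<in> Arr C" "Dom C k = Cod C f"
  shows "k \<cdot> (f \<^bold>- g) = k \<cdot> f \<^bold>- k \<cdot> g"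
  using assms by (simp add: diff_map_def Comp_add_map Comp_neg_map)

lemma diff_zero_map [simp]:
  assumes "f \<in> Arr C" "Dom C f = A" "Cod C f = B"
  shows "f \<^bold>- \<zero> A B = f"
proof -
  have O: "A \<in> Obj C" "B \<in> Obj C" using assms by auto
  then have "neg_map C (\<zero> A B) = \<zero> A B"
    by (intro neg_map_eqI) simp_all
  then show ?thesis using assms by (simp add: diff_map_def)
qed

text \<open>The order of the terms matches the second component of \<open>fusion_section\<close>
  after the fusion operator, where T 0 \<cdot> \<pi>1 is first added and then subtracted.\<close>

lemma add_diff_cancel_left [simp]:
  assumes "f \<in> Arr C" "g \<in> Arr C" "Dom C g = Dom C f" "Cod C g = Cod C f"
  shows "f \<^bold>+ g \<^bold>- f = g"
proof -
  let ?A = "Dom C f" and ?B = "Cod C f"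
  have H: "f \<in> Hom C ?A ?B" "g \<in> Hom C ?A ?B" "neg_map C f \<in> Hom C ?A ?B"
    using assms by (simp_all add: Hom_iff)
  have "f \<^bold>+ g \<^bold>- f = g \<^bold>+ (f \<^bold>+ neg_map C f)"
    unfolding diff_map_def add_map_commute[OF H(1,2)] using add_map_assoc[OF H(2,1,3)] .
  then show ?thesis using assms by simp
qed

end

section \<open>The fusion operator\<close>

lemma category_prod_cat:
  assumes "category C" "category D"
  shows "category (prod_cat C D)"
proof -
  interpret C: category C by fact
  interpret D: category D by fact
  show ?thesis
    by unfold_locales (auto simp: prod_cat_def Hom_iff)
qed

locale biproduct_monad = biproduct_category C + monad C T \<mu> \<eta>
  for C :: "('o, 'm, 'z) bicat_scheme" (structure)
    and T :: "('o, 'm, 'o, 'm) fctr" and \<mu> :: "'o \<Rightarrow> 'm" and \<eta> :: "'o \<Rightarrow> 'm"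
begin

section \<open>Rewriting with the functor, the unit and the multiplication\<close>

declare T.ObjMap_in_Obj [simp] T.ArrMap_Ident [simp]

lemma ArrMap_arr [simp]:
  assumes "f \<in> Arr C"
  shows "ArrMap T f \<in> Arr C" "Dom C (ArrMap T f) = ObjMap T (Dom C f)"
    "Cod C (ArrMap T f) = ObjMap T (Cod C f)"
  using T.ArrMap_in_Hom[of f "Dom C f" "Cod C f"] assms by (auto simp: Hom_iff)

text \<open>Oriented to collect composites under \<open>T\<close>, so that the equations between
  projections and injections apply inside it.\<close>

lemma ArrMap_fold [simp]:
  assumes "f \<in> Arr C" "g \<in> Arr C" "Dom C g = Cod C f"
  shows "ArrMap T g \<cdot> ArrMap T f = ArrMap T (g \<cdot> f)"
  using T.ArrMap_Comp[of f "Dom C f" "Cod C f" g "Cod C g"] assms by (simp add: Hom_iff)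

lemma ArrMap_fold_Comp [simp]:
  assumes "f \<in> Arr C" "g \<in> Arr C" "Dom C g = Cod C f" "k \<in> Arr C" "Cod C k = ObjMap T (Dom C f)"
  shows "ArrMap T g \<cdot> ArrMap T f \<cdot> k = ArrMap T (g \<cdot> f) \<cdot> k"
  using assms by (simp add: Comp_reduce[OF ArrMap_fold])

lemma unit_arr [simp]:
  assumes "A \<in> Obj C"
  shows "\<eta> A \<in> Arr C" "Dom C (\<eta> A) = A" "Cod C (\<eta> A) = ObjMap T A"
  using \<eta>.component_in_Hom[OF assms] by (auto simp: Hom_iff id_fctr_def)

lemma mult_arr [simp]:
  assumes "A \<in> Obj C"
  shows "\<mu> A \<in> Arr C" "Dom C (\<mu> A) = ObjMap T (ObjMap T A)" "Cod C (\<mu> A) = ObjMap T A"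
  using \<mu>.component_in_Hom[OF assms] by (auto simp: Hom_iff comp_fctr_def)

text \<open>Moving \<eta> to the left turns T 0 \<cdot> \<eta> into \<eta> \<cdot> 0, which
  \<open>Comp_zero_map\<close> reduces to a zero map although \<open>T\<close> itself need not
  preserve zero maps.\<close>

lemma unit_natural [simp]:
  assumes "f \<in> Arr C" "Dom C f = A"
  shows "ArrMap T f \<cdot> \<eta> A = \<eta> (Cod C f) \<cdot> f"
  using \<eta>.naturality[of f A "Cod C f"] assms by (simp add: Hom_iff id_fctr_def)

lemma unit_natural_Comp [simp]:
  assumes "f \<in> Arr C" "Dom C f = A" "k \<in> Arr C" "Cod C k = A"
  shows "ArrMap T f \<cdot> \<eta> A \<cdot> k = \<eta> (Cod C f) \<cdot> f \<cdot> k"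
  using assms by (auto simp: Comp_reduce[OF unit_natural])

lemma mult_natural:
  assumes "f \<in> Arr C"
  shows "\<mu> (Cod C f) \<cdot> ArrMap T (ArrMap T f) = ArrMap T f \<cdot> \<mu> (Dom C f)"
  using \<mu>.naturality[of f "Dom C f" "Cod C f"] assms by (simp add: Hom_iff comp_fctr_def)

declare unit_left [simp] unit_right [simp]

lemma unit_left_Comp [simp]:
  assumes "A \<in> Obj C" "k \<in> Arr C" "Cod C k = ObjMap T A"
  shows "\<mu> A \<cdot> \<eta> (ObjMap T A) \<cdot> k = k"
  using assms by (simp add: Comp_reduce[OF unit_left])

text \<open>The zero map into \<open>ObjMap T B\<close> factors as \<open>\<eta> B\<close> after the
  zero map into \<open>B\<close>, and \<open>unit_right\<close> cancels \<mu> against T \<eta>. The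
  result T 0 may be nonzero, which is why the inverse needs a correction term.\<close>

lemma mult_ArrMap_zero [simp]:
  assumes "A \<in> Obj C" "B \<in> Obj C"
  shows "\<mu> B \<cdot> ArrMap T (\<zero> A (ObjMap T B)) = ArrMap T (\<zero> A B)"
proof -
  have "ArrMap T (\<zero> A (ObjMap T B)) = ArrMap T (\<eta> B) \<cdot> ArrMap T (\<zero> A B)"
    using assms by simp
  also have "\<mu> B \<cdot> \<dots> = ArrMap T (\<zero> A B)"
    using assms by (subst Comp_reduce[OF unit_right]) (simp_all del: ArrMap_fold)
  finally show ?thesis .
qed

lemma mult_ArrMap_zero_Comp [simp]:
  assumes "A \<in> Obj C" "B \<in> Obj C" "k \<in> Arr C" "Cod C k = ObjMap T A"
  shows "\<mu> B \<cdot> ArrMap T (\<zero> A (ObjMap T B)) \<cdot> k = ArrMap T (\<zero> A B) \<cdot> k"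
  using assms by (simp add: Comp_reduce[OF mult_ArrMap_zero])

section \<open>Components and naturality of the fusion operator\<close>

lemma fusion_arr [simp]:
  assumes "A \<in> Obj C" "B \<in> Obj C"
  shows "fusion C T \<mu> (A, B) \<in> Arr C"
    "Dom C (fusion C T \<mu> (A, B)) = ObjMap T (A \<oplus> ObjMap T B)"
    "Cod C (fusion C T \<mu> (A, B)) = ObjMap T A \<oplus> ObjMap T B"
  using assms by (simp_all add: fusion_def)

text \<open>Later arguments use the fusion operator only through these two components; the sum
  defining it is not unfolded again.\<close>

lemma Proj_fusion [simp]:
  assumes "A \<in> Obj C" "B \<in> Obj C"
  shows "\<pi>1 (ObjMap T A) (ObjMap T B) \<cdot> fusion C T \<mu> (A, B) = ArrMap T (\<pi>1 A (ObjMap T B))"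
    "\<pi>2 (ObjMap T A) (ObjMap T B) \<cdot> fusion C T \<mu> (A, B) = \<mu> B \<cdot> ArrMap T (\<pi>2 A (ObjMap T B))"
  using assms by (simp_all add: fusion_def Comp_add_map)

lemma Proj_fusion_Comp [simp]:
  assumes "A \<in> Obj C" "B \<in> Obj C" "k \<in> Arr C" "Cod C k = ObjMap T (A \<oplus> ObjMap T B)"
  shows "\<pi>1 (ObjMap T A) (ObjMap T B) \<cdot> fusion C T \<mu> (A, B) \<cdot> k = ArrMap T (\<pi>1 A (ObjMap T B)) \<cdot> k"
    "\<pi>2 (ObjMap T A) (ObjMap T B) \<cdot> fusion C T \<mu> (A, B) \<cdot> k
      = \<mu> B \<cdot> ArrMap T (\<pi>2 A (ObjMap T B)) \<cdot> k"
  using assms by (simp_all add: Comp_reduce[OF Proj_fusion(1)] Comp_reduce[OF Proj_fusion(2)])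

text \<open>Checked on the two projections: the first component is functoriality of
  \<open>T\<close>, the second is naturality of \<mu>.\<close>

lemma fusion_natural:
  assumes "f \<in> Arr C" "g \<in> Arr C"
  shows "fusion C T \<mu> (Cod C f, Cod C g) \<cdot> ArrMap T (bsum_map C f (ArrMap T g))
    = bsum_map C (ArrMap T f) (ArrMap T g) \<cdot> fusion C T \<mu> (Dom C f, Dom C g)"
proof (rule product_ext[of "ObjMap T (Cod C f)" "ObjMap T (Cod C g)"])
  have "\<mu> (Cod C g) \<cdot> ArrMap T (ArrMap T g \<cdot> \<pi>2 (Dom C f) (ObjMap T (Dom C g)))
      = \<mu> (Cod C g) \<cdot> ArrMap T (ArrMap T g) \<cdot> ArrMap T (\<pi>2 (Dom C f) (ObjMap T (Dom C g)))"
    using assms by simp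
  also have "\<dots> = ArrMap T g \<cdot> \<mu> (Dom C g) \<cdot> ArrMap T (\<pi>2 (Dom C f) (ObjMap T (Dom C g)))"
    using assms by (subst Comp_reduce[OF mult_natural]) (simp_all del: ArrMap_fold)
  finally show "\<pi>2 (ObjMap T (Cod C f)) (ObjMap T (Cod C g)) \<cdot>
      fusion C T \<mu> (Cod C f, Cod C g) \<cdot> ArrMap T (bsum_map C f (ArrMap T g))
    = \<pi>2 (ObjMap T (Cod C f)) (ObjMap T (Cod C g)) \<cdot>
      bsum_map C (ArrMap T f) (ArrMap T g) \<cdot> fusion C T \<mu> (Dom C f, Dom C g)"
    using assms by simp
qed (use assms in simp_all)

lemma natural_transformation_fusion:
  "natural_transformation (prod_cat C C) C (fusion_source C T) (fusion_target C T) (fusion C T \<mu>)"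
proof -
  interpret P: category "prod_cat C C"
    by (rule category_prod_cat) unfold_locales
  \<comment> \<open>Functoriality of source and target requires \<open>T\<close> to be distributed
    over composites, so \<open>ArrMap_fold\<close> is used in reverse.\<close>
  show ?thesis
    by unfold_locales
      (auto simp: prod_cat_def fusion_source_def fusion_target_def Hom_iff bsum_map_Comp
        simp flip: ArrMap_fold, simp_all add: fusion_natural)
qed

text \<open>Naturality of the fusion operator is automatic by
  \<open>natural_transformation_fusion\<close>, so the Hopf condition only adds invertibility of
  each component.\<close>

lemma hopf_monad_iff:
  "hopf_monad C T \<mu> \<eta> \<longleftrightarrow> (\<forall>A \<in> Obj C. \<forall>B \<in> Obj C. is_iso C (fusion C T \<mu> (A, B)))"
proof
  assume "hopf_monad C T \<mu> \<eta>"
  then interpret H: hopf_monad C T \<mu> \<eta> .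
  interpret N: natural_isomorphism "prod_cat C C" C "fusion_source C T" "fusion_target C T" "fusion C T \<mu>"
    by (rule H.fusion_iso)
  show "\<forall>A \<in> Obj C. \<forall>B \<in> Obj C. is_iso C (fusion C T \<mu> (A, B))"
    using N.component_iso by (simp add: prod_cat_def)
next
  assume iso: "\<forall>A \<in> Obj C. \<forall>B \<in> Obj C. is_iso C (fusion C T \<mu> (A, B))"
  interpret N: natural_transformation "prod_cat C C" C "fusion_source C T" "fusion_target C T" "fusion C T \<mu>"
    by (rule natural_transformation_fusion)
  show "hopf_monad C T \<mu> \<eta>"
    by unfold_locales (use iso in \<open>auto simp: prod_cat_def\<close>)
qed

end

section \<open>The section of the fusion operator and invertibility\<close>

locale biproduct_monad_with_negatives =
  biproduct_category_with_negatives C + biproduct_monad C T \<mu> \<eta>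
  for C :: "('o, 'm, 'z) bicat_scheme" (structure)
    and T :: "('o, 'm, 'o, 'm) fctr" and \<mu> :: "'o \<Rightarrow> 'm" and \<eta> :: "'o \<Rightarrow> 'm"
begin

text \<open>The candidate inverse. The first two summands insert the two components; the subtracted
  one removes the stray T 0 \<cdot> \<pi>1 that the first summand leaves in the second
  component.\<close>

definition fusion_section :: "'o \<Rightarrow> 'o \<Rightarrow> 'm" where
  "fusion_section A B = (let TA = ObjMap T A; TB = ObjMap T B in
     ArrMap T (\<iota>1 A TB) \<cdot> \<pi>1 TA TB
     \<^bold>+ ArrMap T (\<iota>2 A TB) \<cdot> \<eta> TB \<cdot> \<pi>2 TA TB
     \<^bold>- ArrMap T (\<iota>2 A TB) \<cdot> \<eta> TB \<cdot> ArrMap T (\<zero> A B) \<cdot> \<pi>1 TA TB)"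

lemma fusion_section_arr [simp]:
  assumes "A \<in> Obj C" "B \<in> Obj C"
  shows "fusion_section A B \<in> Arr C" "Dom C (fusion_section A B) = ObjMap T A \<oplus> ObjMap T B"
    "Cod C (fusion_section A B) = ObjMap T (A \<oplus> ObjMap T B)"
  using assms by (simp_all add: fusion_section_def Let_def)

text \<open>In the first component the last two summands vanish because T 0 \<cdot> \<eta> = 0. The
  second component is T 0 \<cdot> \<pi>1 + \<pi>2 - T 0 \<cdot> \<pi>1, by
  \<open>mult_ArrMap_zero\<close> and \<open>unit_left\<close>.\<close>

lemma fusion_fusion_section:
  assumes "A \<in> Obj C" "B \<in> Obj C"
  shows "fusion C T \<mu> (A, B) \<cdot> fusion_section A B = \<one> (ObjMap T A \<oplus> ObjMap T B)"
  by (rule product_ext[of "ObjMap T A" "ObjMap T B"])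
    (use assms in \<open>simp_all, simp_all add: fusion_section_def Let_def Comp_diff_map Comp_add_map\<close>)

text \<open>After distributing, \<open>Proj_fusion\<close> evaluates the projections; functoriality
  merges T \<iota>1 \<cdot> T \<pi>1 into T (\<iota>1 \<cdot> \<pi>1) and T 0 \<cdot> T \<pi>1 into
  T 0. \<open>bsum_map_Ident_zero\<close> matches \<iota>1 \<cdot> \<pi>1 with 1 \<oplus> 0.\<close>

lemma fusion_section_fusion:
  assumes "A \<in> Obj C" "B \<in> Obj C"
  shows "fusion_section A B \<cdot> fusion C T \<mu> (A, B) = (let TB = ObjMap T B in
        ArrMap T (bsum_map C (\<one> A) (\<zero> TB TB))
        \<^bold>+ ArrMap T (\<iota>2 A TB) \<cdot> \<eta> TB \<cdot> \<mu> B \<cdot> ArrMap T (\<pi>2 A TB)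
        \<^bold>- ArrMap T (\<iota>2 A TB) \<cdot> \<eta> TB \<cdot> ArrMap T (\<zero> (A \<oplus> TB) B))"
  using assms
  by (simp add: fusion_section_def Let_def bsum_map_Ident_zero diff_map_Comp add_map_Comp)

text \<open>Any left inverse of a map with a section coincides with that section, so
  \<open>fusion_section\<close> is the only possible inverse.\<close>

lemma is_iso_fusion_iff:
  assumes "A \<in> Obj C" "B \<in> Obj C"
  shows "is_iso C (fusion C T \<mu> (A, B)) \<longleftrightarrow>
    fusion_section A B \<cdot> fusion C T \<mu> (A, B) = \<one> (ObjMap T (A \<oplus> ObjMap T B))"
    (is "?iso \<longleftrightarrow> ?s \<cdot> ?h = ?id")
proof
  assume ?iso
  then obtain k where k: "k \<in> Arr C" "Dom C k = Cod C ?h" "Cod C k = Dom C ?h" "k \<cdot> ?h = \<one> (Dom C ?h)"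
    by (auto simp: is_iso_def Hom_iff)
  \<comment> \<open>Here \<open>?h \<cdot> ?s\<close> is the identity; regrouping then cancels
    \<open>k \<cdot> ?h\<close> instead and leaves \<open>?s\<close>.\<close>
  have "k = k \<cdot> ?h \<cdot> ?s"
    using k(1,2) assms by (simp add: fusion_fusion_section)
  also have "\<dots> = ?s"
    using k assms by (subst Comp_reduce[OF k(4)]) simp_all
  finally show "?s \<cdot> ?h = ?id"
    using k assms by simp
next
  assume "?s \<cdot> ?h = ?id"
  then show ?iso
    using assms fusion_fusion_section[OF assms] fusion_section_arr[OF assms]
    unfolding is_iso_def by (auto simp: Hom_iff intro!: bexI[of _ ?s])
qed

end

theorem proposition6p3:
  fixes X :: "('o, 'm, 'z) bicat_scheme" (structure)
    and T :: "('o, 'm, 'o, 'm) fctr" and \<mu> \<eta> :: "'o \<Rightarrow> 'm"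
  assumes "biproduct_category X"
    and "has_negatives X"
    and "monad X T \<mu> \<eta>"
  shows "hopf_monad X T \<mu> \<eta> \<longleftrightarrow>
    (\<forall>A \<in> Obj X. \<forall>B \<in> Obj X.
      (let TB = ObjMap T B in
        ArrMap T (bsum_map X (\<one> A) (\<zero> TB TB))
        \<^bold>+ ArrMap T (\<iota>2 A TB) \<cdot> \<eta> TB \<cdot> \<mu> B \<cdot> ArrMap T (\<pi>2 A TB)
        \<^bold>- ArrMap T (\<iota>2 A TB) \<cdot> \<eta> TB \<cdot> ArrMap T (\<zero> (A \<oplus> TB) B)
        = \<one> (ObjMap T (A \<oplus> TB))))"
proof -
  interpret biproduct_monad_with_negatives X T \<mu> \<eta>
    using assms by (intro biproduct_monad_with_negatives.intro biproduct_monad.intro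
        biproduct_category_with_negatives.intro biproduct_category_with_negatives_axioms.intro)
  \<comment> \<open>Both sides range over the same pairs of objects, so it suffices to compare them
    at a single pair.\<close>
  show ?thesis
    unfolding hopf_monad_iff
    by (intro ball_cong refl)
      (simp only: is_iso_fusion_iff fusion_section_fusion Let_def)
qed

end
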